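(* Let $H$ be an even $3$--hypergraph. Then $\chi(H)\leq \chi(\mathrm{link}_H(v))$ for every $v\in V(H)$.
   Context: A $3$--hypergraph $H$ has a finite vertex set $V(H)$ and edge set $E(H)\subseteq\binom{V(H)}{3}$; $\chi(H)$ is the minimum number of classes in a partition of $V(H)$ with no edge inside a single class. $H$ is even if every $4$-element subset of $V(H)$ contains an even number of edges of $H$. For $v\in V(H)$, $\mathrm{link}_H(v)$ is the simple graph with vertex set $\{w\neq v : \{v,w\}\subset e \text{ for some } e\in E(H)\}$ and edge set $\{\{u,w\}: \{v,u,w\}\in E(H)\}$; $\chi$ of a graph is its usual chromatic number.
   Formalization: The chromatic number of a graph is taken as the least positive number of colours, so an empty link has chromatic number 1 rather than 0; with the value 0 the claim fails when H has no edges (e.g. V(H)={v}); for H with an edge nothing changes. *)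

theory Defs
  imports "HOL-Library.Disjoint_Sets" "HOL-Library.Ramsey"
begin

definition hypergraph3 :: "'a set \<Rightarrow> 'a set set \<Rightarrow> bool" where
  "hypergraph3 V E \<longleftrightarrow> finite V \<and> E \<subseteq> [V]\<^bsup>3\<^esup>"

definition hypergraph_chromatic_number :: "'a set \<Rightarrow> 'a set set \<Rightarrow> nat" where
  "hypergraph_chromatic_number V E =
     (LEAST k. \<exists>P. partition_on V P \<and> card P = k \<and> (\<forall>A\<in>P. \<forall>e\<in>E. \<not> e \<subseteq> A))"

definition even_hypergraph3 :: "'a set \<Rightarrow> 'a set set \<Rightarrow> bool" where
  "even_hypergraph3 V E \<longleftrightarrow> hypergraph3 V E \<and> (\<forall>S\<in>[V]\<^bsup>4\<^esup>. even (card {e \<in> E. e \<subseteq> S}))"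

definition link_verts :: "'a set set \<Rightarrow> 'a \<Rightarrow> 'a set" where
  "link_verts E v = {w. w \<noteq> v \<and> (\<exists>e\<in>E. {v, w} \<subseteq> e)}"

definition link_edges :: "'a set set \<Rightarrow> 'a \<Rightarrow> 'a set set" where
  "link_edges E v = {{u, w} |u w. {v, u, w} \<in> E}"

definition proper_coloring :: "'a set \<Rightarrow> 'a set set \<Rightarrow> nat \<Rightarrow> ('a \<Rightarrow> nat) \<Rightarrow> bool" where
  "proper_coloring W F k c \<longleftrightarrow>
     c ` W \<subseteq> {..<k} \<and> (\<forall>u\<in>W. \<forall>w\<in>W. {u, w} \<in> F \<longrightarrow> c u \<noteq> c w)"

text \<open>
  The chromatic number of a graph is the least \<^emph>\<open>positive\<close> number of colours admitting a proper
  colouring.  Positivity matters only for the graph without vertices, whose chromatic number is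
  thereby 1.  This graph does occur as a link, exactly when \<open>v\<close> lies in no edge; an even
  hypergraph \<open>H\<close> with such a vertex \<open>v\<close> has no edges, so \<open>\<chi>(H) = 1\<close>, and
  \<open>\<chi>(H) \<le> \<chi>(link\<^sub>H(v))\<close> would fail there if the empty graph had chromatic number 0.
\<close>

definition graph_chromatic_number :: "'a set \<Rightarrow> 'a set set \<Rightarrow> nat" where
  "graph_chromatic_number W F = (LEAST k. 0 < k \<and> (\<exists>c. proper_coloring W F k c))"

lemma graph_chromatic_number_nonempty:
  assumes "W \<noteq> {}"
  shows "graph_chromatic_number W F = (LEAST k. \<exists>c. proper_coloring W F k c)"
proof -
  have "0 < k" if "proper_coloring W F k c" for k c
    using assms that by (cases k) (auto simp: proper_coloring_def)
  then have "(\<lambda>k. 0 < k \<and> (\<exists>c. proper_coloring W F k c)) = (\<lambda>k. \<exists>c. proper_coloring W F k c)"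
    by blast
  then show ?thesis
    by (simp add: graph_chromatic_number_def)
qed

end

theory Submission imports Defs begin

text \<open>
  Extend a proper colouring of the link of \<open>v\<close> to \<open>V\<close> by giving colour 0 to every other vertex.
  Every edge of the hypergraph contains an edge of the link: this is clear for the edges through
  \<open>v\<close>, and if \<open>v \<notin> e \<in> E\<close>, then by evenness the 4-set \<open>e \<union> {v}\<close> contains a second
  edge, which passes through \<open>v\<close>. Hence no edge is monochromatic.
\<close>

lemma hypergraph3_edge:
  assumes "hypergraph3 V E" and "e \<in> E"
  shows "e \<subseteq> V" and "finite e" and "card e = 3"
  using assms by (auto simp: hypergraph3_def nsets_def)

lemma link_edges_iff: "{u, w} \<in> link_edges E v \<longleftrightarrow> {v, u, w} \<in> E"
proof
  assume "{u, w} \<in> link_edges E v"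
  then obtain a b where ab: "{u, w} = {a, b}" "{v, a, b} \<in> E"
    by (auto simp: link_edges_def)
  \<comment> \<open>\<open>{v, a, b}\<close> is \<open>insert v {a, b}\<close>, so the pair is
    replaced as a whole, whichever way \<open>a\<close> and \<open>b\<close> match \<open>u\<close>
    and \<open>w\<close>.\<close>
  from ab(2) show "{v, u, w} \<in> E"
    unfolding ab(1)[symmetric] .
qed (auto simp: link_edges_def)

lemma link_edge_subset_edge_through:
  assumes "hypergraph3 V E" and "e \<in> E" and "v \<in> e"
  obtains x y where "{x, y} \<subseteq> e" and "x \<noteq> v" and "y \<noteq> v" and "{v, x, y} \<in> E"
proof -
  have "card (e - {v}) = 2"
    using hypergraph3_edge[OF assms(1,2)] assms(3) by simp
  then obtain x y where xy: "e - {v} = {x, y}"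
    by (auto simp: card_2_iff)
  then have "e = {v, x, y}"
    using assms(3) by blast
  then show thesis
    using that[of x y] xy assms(2) by blast
qed

lemma even_hypergraph3_link_edge_subset:
  assumes even: "even_hypergraph3 V E" and "v \<in> V" and e: "e \<in> E"
  obtains x y where "{x, y} \<subseteq> e" and "x \<noteq> v" and "y \<noteq> v" and "{v, x, y} \<in> E"
proof (cases "v \<in> e")
  case True
  then show thesis
    using link_edge_subset_edge_through[of V E e v] even e that
    unfolding even_hypergraph3_def by metis
next
  case False
  have hyp: "hypergraph3 V E"
    using even by (simp add: even_hypergraph3_def)
  note e_props = hypergraph3_edge[OF hyp e]
  let ?S = "insert v e"
  have "?S \<in> [V]\<^bsup>4\<^esup>"
    using e_props False \<open>v \<in> V\<close> by (auto simp: nsets_def)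
  then have "even (card {d \<in> E. d \<subseteq> ?S})"
    using even by (simp add: even_hypergraph3_def)
  \<comment> \<open>A singleton has odd cardinality.\<close>
  then have "{d \<in> E. d \<subseteq> ?S} \<noteq> {e}"
    by auto
  then obtain d where d: "d \<in> E" "d \<subseteq> ?S" "d \<noteq> e"
    using e by blast
  \<comment> \<open>Otherwise \<open>d\<close> would be a 3-subset of the 3-set \<open>e\<close>,
    hence equal to \<open>e\<close>.\<close>
  have "v \<in> d"
  proof (rule ccontr)
    assume "v \<notin> d"
    then have "d \<subseteq> e"
      using d by blast
    then show False
      using card_subset_eq[of e d] e_props hypergraph3_edge[OF hyp d(1)] d(3) by simp
  qed
  then obtain x y where "{x, y} \<subseteq> d" "x \<noteq> v" "y \<noteq> v" "{v, x, y} \<in> E"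
    using link_edge_subset_edge_through[OF hyp d(1)] by metis
  \<comment> \<open>Since \<open>x\<close> and \<open>y\<close> differ from \<open>v\<close>, the
    only point of \<open>?S\<close> outside \<open>e\<close>, the pair found in \<open>d\<close>
    lies in \<open>e\<close>.\<close>
  then show thesis
    using that[of x y] d(2) by blast
qed

text \<open>Giving all vertices different colours works, because 3-element edges leave no loops in
  the link. This guarantees that the \<open>LEAST\<close> in \<open>graph_chromatic_number\<close>
  is attained.\<close>

lemma proper_coloring_link_exists:
  assumes "hypergraph3 V E"
  shows "\<exists>k>0. \<exists>c. proper_coloring (link_verts E v) (link_edges E v) k c"
proof -
  have "link_verts E v \<subseteq> V"
    using assms by (auto simp: link_verts_def hypergraph3_def nsets_def)
  then have "finite (link_verts E v)"
    using assms finite_subset by (auto simp: hypergraph3_def)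
  then obtain c :: "'a \<Rightarrow> nat" and n
    where c: "c ` link_verts E v = {i. i < n}" "inj_on c (link_verts E v)"
    using finite_imp_inj_to_nat_seg by metis
  have "u \<noteq> w" if "{v, u, w} \<in> E" for u w
    using hypergraph3_edge(3)[OF assms that] by (auto simp: card_insert_if split: if_splits)
  \<comment> \<open>\<open>Suc n\<close> keeps the number of colours positive when the link is empty
    and \<open>n = 0\<close>.\<close>
  then have "proper_coloring (link_verts E v) (link_edges E v) (Suc n) c"
    unfolding proper_coloring_def link_edges_iff
    using c by (auto simp: inj_on_eq_iff)
  then show ?thesis
    by blast
qed

text \<open>The fibres of \<open>f\<close> on \<open>V\<close> are the classes; this passes from
  colourings, used for graphs, to partitions, used for hypergraphs.\<close>

lemma hypergraph_chromatic_number_le: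
  fixes f :: "'a \<Rightarrow> nat"
  assumes "f ` V \<subseteq> {..<k}"
    and edges: "\<And>e. e \<in> E \<Longrightarrow> \<exists>x\<in>e. \<exists>y\<in>e. f x \<noteq> f y"
  shows "hypergraph_chromatic_number V E \<le> k"
proof -
  let ?P = "(\<lambda>i. {x \<in> V. f x = i}) ` f ` V"
  have "partition_on V ?P"
    by (auto simp: partition_on_def disjoint_def)
  moreover have "\<forall>A\<in>?P. \<forall>e\<in>E. \<not> e \<subseteq> A"
  proof (intro ballI notI)
    fix A e assume "A \<in> ?P" "e \<in> E" "e \<subseteq> A"
    then obtain i where "\<And>x. x \<in> e \<Longrightarrow> f x = i"
      by blast
    then show False
      using edges[OF \<open>e \<in> E\<close>] by auto
  qed
  ultimately have "hypergraph_chromatic_number V E \<le> card ?P"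
    unfolding hypergraph_chromatic_number_def by (intro Least_le) blast
  also have "\<dots> \<le> card (f ` V)"
    using assms(1) finite_subset by (intro card_image_le) blast
  also have "\<dots> \<le> k"
    using card_mono[OF _ assms(1)] by simp
  finally show ?thesis .
qed

theorem lemma1:
  fixes V :: "'a set" and E :: "'a set set"
  assumes "even_hypergraph3 V E"
    and "v \<in> V"
  shows "hypergraph_chromatic_number V E
           \<le> graph_chromatic_number (link_verts E v) (link_edges E v)"
proof -
  let ?W = "link_verts E v" and ?F = "link_edges E v"
  let ?k = "graph_chromatic_number ?W ?F"
  have "hypergraph3 V E"
    using assms(1) by (simp add: even_hypergraph3_def)
  then have "0 < ?k \<and> (\<exists>c. proper_coloring ?W ?F ?k c)"
    unfolding graph_chromatic_number_def
    by (rule LeastI_ex[OF proper_coloring_link_exists])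
  then obtain c where "0 < ?k" and c: "proper_coloring ?W ?F ?k c"
    by blast
  \<comment> \<open>The default 0 is an admissible colour because \<open>0 < ?k\<close>.\<close>
  define f where "f x = (if x \<in> ?W then c x else 0)" for x
  show ?thesis
  proof (rule hypergraph_chromatic_number_le)
    show "f ` V \<subseteq> {..<?k}"
      using c \<open>0 < ?k\<close> by (auto simp: f_def proper_coloring_def)
  next
    fix e assume "e \<in> E"
    then obtain x y where xy: "{x, y} \<subseteq> e" "x \<noteq> v" "y \<noteq> v" "{v, x, y} \<in> E"
      using even_hypergraph3_link_edge_subset[OF assms] by metis
    then have "x \<in> ?W" "y \<in> ?W"
      by (auto simp: link_verts_def)
    then have "f x \<noteq> f y"
      using c xy(4) by (simp add: f_def proper_coloring_def link_edges_iff)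
    then show "\<exists>x\<in>e. \<exists>y\<in>e. f x \<noteq> f y"
      using xy(1) by blast
  qed
qed

end
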